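(* Let $t\ge 1$ and let $n_1,n_2,\dots,n_t$ be positive integers with $n_1=\max\{n_1,n_2,\dots,n_t\}$. Let $G$ be a finite simple graph with $\chi(G)\ge n_1+1+\sum_{i=1}^t (n_i-1)$. Then in every coloring of the edges of $G$ with colors $1,2,\dots,t$, there exists some $i\in\{1,\dots,t\}$ such that $G$ contains $n_i$ pairwise vertex-disjoint edges all of color $i$.
   Context: The chromatic number $\chi(G)$ of a graph $G$ is the minimum number of colors needed to color the vertices of $G$ so that adjacent vertices receive different colors. Edge colorings are arbitrary (not necessarily proper). *)

theory Defs
  imports Main
begin

text \<open>Edges are unordered pairs, i.e. two-element sets of vertices, so that an
  arbitrary edge coloring is just a function on \<open>E\<close>.\<close>

locale finite_simple_graph =
  fixes V :: "'a set" and E :: "'a set set"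
  assumes finite_V: "finite V"
    and edges: "e \<in> E \<Longrightarrow> e \<subseteq> V \<and> card e = 2"

definition proper_vertex_coloring :: "'a set \<Rightarrow> 'a set set \<Rightarrow> nat \<Rightarrow> ('a \<Rightarrow> nat) \<Rightarrow> bool" where
  "proper_vertex_coloring V E k f \<longleftrightarrow>
     (\<forall>v\<in>V. f v < k) \<and> (\<forall>u\<in>V. \<forall>v\<in>V. {u, v} \<in> E \<longrightarrow> f u \<noteq> f v)"

definition chromatic_number :: "'a set \<Rightarrow> 'a set set \<Rightarrow> nat" where
  "chromatic_number V E = (LEAST k. \<exists>f. proper_vertex_coloring V E k f)"

text \<open>The minimum is attained, so \<open>LEAST\<close> is meaningful on finite simple graphs.\<close>

lemma (in finite_simple_graph) chromatic_number_attained: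
  "\<exists>f. proper_vertex_coloring V E (chromatic_number V E) f"
proof -
  obtain f where f: "bij_betw f V {0..<card V}"
    using ex_bij_betw_finite_nat[OF finite_V] by blast
  have "f u \<noteq> f v" if "u \<in> V" "v \<in> V" "{u, v} \<in> E" for u v
  proof
    assume "f u = f v"
    with f that have "u = v"
      by (auto simp: bij_betw_def inj_on_def)
    with edges[OF that(3)] show False
      by simp
  qed
  moreover have "f v < card V" if "v \<in> V" for v
    using bij_betwE[OF f] that by auto
  ultimately have "proper_vertex_coloring V E (card V) f"
    unfolding proper_vertex_coloring_def by blast
  then show ?thesis
    unfolding chromatic_number_def
    by (intro LeastI[where P = "\<lambda>k. \<exists>f. proper_vertex_coloring V E k f"]) blast
qed

end

theory Submission
  imports Defs Complex_Main
begin

text \<open>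
  If no color \<open>i\<close> has a matching of size \<open>n\<^sub>i\<close>, a Gallai--Edmonds style argument yields vertex
  sets \<open>S\<^sub>i\<close> and numbers \<open>m\<^sub>i\<close> with \<open>|S\<^sub>i| + m\<^sub>i \<le> n\<^sub>i - 1\<close> such that at most \<open>m\<^sub>i(2m\<^sub>i + 1)\<close>
  edges of color \<open>i\<close> avoid \<open>S\<^sub>i\<close>. Since a graph needing \<open>k + 1\<close> colors has at least
  \<open>k(k + 1)/2\<close> edges, and since \<open>4 M (\<Sum>m\<^sub>i) \<le> (M + \<Sum>m\<^sub>i)\<^sup>2\<close> with \<open>M = n\<^sub>1 - 1 \<ge> m\<^sub>i\<close>, the edges
  that avoid every \<open>S\<^sub>i\<close> can be properly colored with \<open>n\<^sub>1 + \<Sum>m\<^sub>i\<close> colors. A private color for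
  each vertex of \<open>\<Union>S\<^sub>i\<close> then gives a coloring with at most \<open>n\<^sub>1 + \<Sum>(n\<^sub>i - 1)\<close> colors.
\<close>

section \<open>Matchings and the exchange argument\<close>

definition matching_in :: "'a set set \<Rightarrow> 'a set set \<Rightarrow> bool" where
  "matching_in E M \<longleftrightarrow> M \<subseteq> E \<and> pairwise disjnt M"

lemma matching_in_insert:
  assumes "matching_in E M" "e \<in> E" "e \<inter> \<Union>M = {}"
  shows "matching_in E (insert e M)"
  using assms unfolding matching_in_def pairwise_insert disjnt_def by blast

lemma matching_in_subset:
  assumes "matching_in E M" "N \<subseteq> M"
  shows "matching_in E N"
  using assms unfolding matching_in_def by (meson pairwise_subset subset_trans)

lemma matching_in_same_edge:
  assumes "matching_in E M" "a \<in> M" "b \<in> M" "v \<in> a" "v \<in> b"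
  shows "a = b"
  using assms unfolding matching_in_def pairwise_def disjnt_def by blast

lemma card_Union_matching:
  assumes "matching_in E M" "finite E" "\<And>e. e \<in> E \<Longrightarrow> card e = 2"
  shows "finite (\<Union>M)" "card (\<Union>M) = 2 * card M"
proof -
  have fin: "finite e" if "e \<in> M" for e
    using assms that unfolding matching_in_def by (metis card.infinite subsetD zero_neq_numeral)
  have "finite M"
    using assms finite_subset unfolding matching_in_def by blast
  then show "finite (\<Union>M)"
    using fin by blast
  have "card (\<Union>M) = sum card M"
    using assms(1) fin unfolding matching_in_def by (intro card_Union_disjoint) auto
  also have "\<dots> = 2 * card M"
    using assms unfolding matching_in_def by (simp add: subset_iff)
  finally show "card (\<Union>M) = 2 * card M" .
qed

text \<open>The local form of Gallai's lemma. Among the matchings \<open>N\<close> that miss \<open>w\<close>, one sharing as many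
  edges as possible with \<open>M\<close> could still be improved by an exchange.\<close>

lemma maximum_matching_two_neighbours:
  fixes E :: "'a set set"
  assumes fin: "finite E"
    and two: "\<And>e. e \<in> E \<Longrightarrow> card e = 2"
    and max: "\<And>M. matching_in E M \<Longrightarrow> card M \<le> k"
    and N0: "matching_in E N0" "card N0 = k" "w \<notin> \<Union>N0"
    and M: "matching_in E M" "card M = k"
    and xw: "{x, w} \<in> E" and yw: "{y, w} \<in> E"
    and x: "x \<notin> \<Union>M" and y: "y \<notin> \<Union>M"
  shows "x = y"
proof (rule ccontr)
  assume "x \<noteq> y"
  have finM: "finite N" if "matching_in E N" for N
    using that fin finite_subset unfolding matching_in_def by blast
  have hit: "e \<inter> \<Union>N \<noteq> {}" if "matching_in E N" "card N = k" "e \<in> E" for N e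
  proof
    assume disj: "e \<inter> \<Union>N = {}"
    have "e \<noteq> {}"
      using two[OF that(3)] by auto
    with disj have "e \<notin> N"
      by blast
    then have "card (insert e N) = Suc k"
      using finM that by simp
    with max[OF matching_in_insert[OF that(1,3) disj]] show False
      by simp
  qed
  define P where "P N \<longleftrightarrow> matching_in E N \<and> card N = k \<and> w \<notin> \<Union>N" for N
  have "\<exists>N. P N \<and> (\<forall>N'. P N' \<longrightarrow> card (N' \<inter> M) \<le> card (N \<inter> M))"
  proof (rule ex_has_greatest_nat[of P N0 _ "Suc k"])
    show "P N0"
      using N0 by (simp add: P_def)
    show "\<forall>N. P N \<longrightarrow> card (N \<inter> M) < Suc k"
      unfolding P_def by (metis Int_lower1 card_mono finM less_Suc_eq_le)
  qed
  then obtain N where PN: "P N" and best: "\<And>N'. P N' \<Longrightarrow> card (N' \<inter> M) \<le> card (N \<inter> M)"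
    by blast
  from PN have N: "matching_in E N" "card N = k" "w \<notin> \<Union>N"
    by (auto simp: P_def)
  note UM = card_Union_matching[OF M(1) fin two]
  note UN = card_Union_matching[OF N(1) fin two]
  \<comment> \<open>Both \<open>x\<close> and \<open>y\<close> are covered by \<open>N\<close> but
    not by \<open>M\<close>. As \<open>M\<close> and \<open>N\<close> cover equally many vertices,
    at least two vertices are covered by \<open>M\<close> but not by \<open>N\<close>, and one of
    them, \<open>z\<close>, differs from \<open>w\<close>.\<close>
  have "x \<in> \<Union>N" "y \<in> \<Union>N"
    using hit[OF N(1,2) xw] hit[OF N(1,2) yw] N(3) by auto
  then have "card {x, y} \<le> card (\<Union>N - \<Union>M)"
    using x y UN by (intro card_mono) auto
  moreover have "card (\<Union>N - \<Union>M) = card (\<Union>M - \<Union>N)"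
    using UM UN M(2) N(2) by (intro antisym card_le_sym_Diff) auto
  ultimately have "2 \<le> card (\<Union>M - \<Union>N)"
    using \<open>x \<noteq> y\<close> by simp
  moreover have "card (\<Union>M - \<Union>N) \<le> 1" if "\<Union>M - \<Union>N \<subseteq> {w}"
    using card_mono[OF _ that] by simp
  ultimately obtain z where z: "z \<in> \<Union>M" "z \<notin> \<Union>N" "z \<noteq> w"
    by fastforce
  then obtain e where e: "e \<in> M" "z \<in> e"
    by blast
  have eE: "e \<in> E"
    using e M unfolding matching_in_def by blast
  obtain z' where z': "z' \<in> e" "z' \<in> \<Union>N"
    using hit[OF N(1,2) eE] by blast
  then obtain d where d: "d \<in> N" "z' \<in> d"
    by blast
  have "z' \<noteq> z"
    using z z' by auto
  then have e_eq: "e = {z, z'}"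
    using two[OF eE] e(2) z'(1) by (auto simp: card_2_iff)
  \<comment> \<open>Exchange: trading \<open>d\<close> for the edge \<open>e\<close> of
    \<open>M\<close> at \<open>z\<close> keeps the size and still misses \<open>w\<close>. Since
    \<open>d\<close> meets \<open>e\<close> and so cannot lie in \<open>M\<close>, the overlap with
    \<open>M\<close> grows, against the choice of \<open>N\<close>.\<close>
  let ?N' = "insert e (N - {d})"
  have "e \<noteq> d"
    using d e z by blast
  have "e \<notin> N"
    using e z by blast
  have "d \<notin> M"
    using matching_in_same_edge[OF M(1) e(1) _ z'(1) d(2)] \<open>e \<noteq> d\<close> by blast
  have "z' \<notin> \<Union>(N - {d})"
    using matching_in_same_edge[OF N(1) d(1) _ d(2)] by blast
  then have "e \<inter> \<Union>(N - {d}) = {}"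
    using z e_eq by blast
  then have "matching_in E ?N'"
    using matching_in_insert[OF matching_in_subset[OF N(1), of "N - {d}"] eE] by blast
  moreover have "card ?N' = k"
    using \<open>e \<notin> N\<close> d finM[OF N(1)] N(2) by (metis Diff_iff card_Suc_Diff1 card_insert_disjoint finite_Diff)
  moreover have "w \<notin> \<Union>?N'"
    using N(3) z z' e_eq by auto
  ultimately have "card (?N' \<inter> M) \<le> card (N \<inter> M)"
    using best by (simp add: P_def)
  moreover have "?N' \<inter> M = insert e (N \<inter> M)"
    using e \<open>d \<notin> M\<close> by blast
  ultimately show False
    using \<open>e \<notin> N\<close> finM[OF N(1)] by simp
qed

section \<open>Edge counts under a bound on matchings\<close>

text \<open>Fix a maximum matching, covering a set of \<open>2 * k\<close> vertices. At most
  \<open>k * (2 * k - 1)\<close> edges lie inside that set. Every other edge has exactly one end in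
  it, and by the exchange lemma no two of these share that end, so there are at most
  \<open>2 * k\<close> of them. The bound is the edge count of a complete graph on
  \<open>2 * k + 1\<close> vertices.\<close>

lemma card_edges_no_essential_vertex:
  fixes E :: "'a set set"
  assumes fin: "finite E"
    and two: "\<And>e. e \<in> E \<Longrightarrow> card e = 2"
    and max: "\<And>M. matching_in E M \<Longrightarrow> card M \<le> k"
    and miss: "\<And>v. \<exists>N. matching_in E N \<and> card N = k \<and> v \<notin> \<Union>N"
  shows "card E \<le> k * (2 * k + 1)"
proof -
  obtain M where M: "matching_in E M" "card M = k"
    using miss by blast
  let ?W = "\<Union>M"
  note W = card_Union_matching[OF M(1) fin two]
  let ?I = "{e \<in> E. e \<subseteq> ?W}" and ?O = "{e \<in> E. \<not> e \<subseteq> ?W}"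
  have "card ?I \<le> card {B. B \<subseteq> ?W \<and> card B = 2}"
    using W two by (intro card_mono) auto
  also have "\<dots> = (2 * k) choose 2"
    using n_subsets[OF W(1)] W(2) M(2) by simp
  also have "\<dots> = k * (2 * k - 1)"
    by (simp add: choose_two)
  finally have I: "card ?I \<le> k * (2 * k - 1)" .
  have "\<exists>w x. e = {x, w} \<and> w \<in> ?W \<and> x \<notin> ?W" if e: "e \<in> ?O" for e
  proof -
    obtain x where x: "x \<in> e" "x \<notin> ?W"
      using e by blast
    obtain w where w: "e = {x, w}" "w \<noteq> x"
      using e x two[of e] by (auto simp: card_2_iff)
    have "w \<in> ?W"
    proof (rule ccontr)
      assume "w \<notin> ?W"
      then have "e \<inter> ?W = {}"
        using x w by blast
      moreover have "e \<notin> M"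
        using x by blast
      moreover have "finite M"
        using M fin finite_subset unfolding matching_in_def by blast
      ultimately have "matching_in E (insert e M)" "card (insert e M) = Suc k"
        using matching_in_insert[OF M(1)] e M by auto
      then show False
        using max by fastforce
    qed
    with x w show ?thesis
      by blast
  qed
  then obtain w x where wx: "\<And>e. e \<in> ?O \<Longrightarrow> e = {x e, w e} \<and> w e \<in> ?W \<and> x e \<notin> ?W"
    by metis
  have "inj_on w ?O"
  proof (rule inj_onI)
    fix a b assume ab: "a \<in> ?O" "b \<in> ?O" "w a = w b"
    obtain N where N: "matching_in E N" "card N = k" "w a \<notin> \<Union>N"
      using miss by blast
    have "{x a, w a} \<in> E" "{x b, w a} \<in> E"
      using wx[OF ab(1)] wx[OF ab(2)] ab by auto
    then have "x a = x b"
      using maximum_matching_two_neighbours[OF fin two max N M] wx[OF ab(1)] wx[OF ab(2)] by blast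
    then show "a = b"
      using wx[OF ab(1)] wx[OF ab(2)] ab(3) by metis
  qed
  moreover have "w ` ?O \<subseteq> ?W"
    using wx by (meson image_subsetI)
  ultimately have O: "card ?O \<le> 2 * k"
    using card_inj_on_le[of w ?O ?W] W M(2) by simp
  have "card E = card ?I + card ?O"
    using fin by (subst card_Un_disjoint[symmetric]) (auto intro: arg_cong[where f = card])
  also have "\<dots> \<le> k * (2 * k - 1) + 2 * k"
    using I O by simp
  also have "\<dots> = k * (2 * k + 1)"
    by (cases k) (auto simp: algebra_simps)
  finally show ?thesis .
qed

text \<open>\<open>S\<close> collects vertices deleted one by one, each lying in every matching of
  the currently allowed maximal size; each deletion lowers that size by one. Once no such vertex is
  left, the remaining bound is \<open>m\<close> and the previous count applies.\<close>

lemma bounded_matching_structure: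
  fixes E :: "'a set set"
  assumes "finite E"
    and "\<And>e. e \<in> E \<Longrightarrow> card e = 2"
    and "\<And>M. matching_in E M \<Longrightarrow> card M \<le> k"
  shows "\<exists>S m. finite S \<and> card S + m \<le> k \<and> card {e \<in> E. e \<inter> S = {}} \<le> m * (2 * m + 1)"
  using assms
proof (induction k arbitrary: E)
  case (0 E)
  have "card E \<le> 0 * (2 * 0 + 1)"
  proof (rule card_edges_no_essential_vertex)
    show "\<exists>N. matching_in E N \<and> card N = 0 \<and> v \<notin> \<Union>N" for v
      by (rule exI[of _ "{}"]) (simp add: matching_in_def)
  qed (use 0 in auto)
  then show ?case
    using 0 by (intro exI[of _ "{}"] exI[of _ 0]) simp
next
  case (Suc k E)
  show ?case
  proof (cases "\<forall>v. \<exists>N. matching_in E N \<and> card N = Suc k \<and> v \<notin> \<Union>N")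
    case True
    then have "card E \<le> Suc k * (2 * Suc k + 1)"
      using card_edges_no_essential_vertex[OF Suc.prems] by blast
    then show ?thesis
      by (intro exI[of _ "{}"] exI[of _ "Suc k"]) simp
  next
    case False
    \<comment> \<open>If there is no matching of size \<open>Suc k\<close> at all, this holds
      vacuously and the deletion merely uses up one unit of the bound.\<close>
    then obtain v where v: "\<And>N. matching_in E N \<Longrightarrow> card N = Suc k \<Longrightarrow> v \<in> \<Union>N"
      by blast
    let ?E = "{e \<in> E. v \<notin> e}"
    have "card M \<le> k" if "matching_in ?E M" for M
    proof -
      have "matching_in E M" "v \<notin> \<Union>M"
        using that unfolding matching_in_def by auto
      then show ?thesis
        using v Suc.prems(3) le_Suc_eq by blast
    qed
    then obtain S m where S: "finite S" "card S + m \<le> k"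
      "card {e \<in> ?E. e \<inter> S = {}} \<le> m * (2 * m + 1)"
      using Suc.IH[of ?E] Suc.prems(1,2) by auto
    have "card (insert v S) + m \<le> Suc k"
      using S card_insert_le_m1[of "Suc (card S)" S v] by simp
    moreover have "{e \<in> E. e \<inter> insert v S = {}} = {e \<in> ?E. e \<inter> S = {}}"
      by auto
    ultimately show ?thesis
      using S by (intro exI[of _ "insert v S"] exI[of _ m]) simp
  qed
qed

section \<open>Colorings from few edges and private colors\<close>

text \<open>Remove a vertex \<open>v\<close>: if it lies on at least \<open>k\<close> edges, it gets
  a color of its own; otherwise it is colored greedily. Edges may leave \<open>V\<close>, so the
  induction only has to drop those at \<open>v\<close>.\<close>

lemma few_edges_colorable:
  fixes V :: "'a set" and E :: "'a set set"
  assumes "finite V" "finite E" "\<And>e. e \<in> E \<Longrightarrow> card e = 2" "2 * card E < k * (k + 1)"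
  shows "\<exists>f. proper_vertex_coloring V E k f"
  using assms
proof (induction V arbitrary: E k rule: finite_induct)
  case empty
  then show ?case
    by (simp add: proper_vertex_coloring_def)
next
  case (insert v V)
  let ?D = "{e \<in> E. v \<in> e}" and ?E = "{e \<in> E. v \<notin> e}"
  have cardE: "card E = card ?D + card ?E"
    using insert.prems(1) by (subst card_Un_disjoint[symmetric]) (auto intro: arg_cong[where f = card])
  have no_loop: "{v} \<notin> E"
    using insert.prems(2)[of "{v}"] by auto
  show ?case
  proof (cases "k \<le> card ?D")
    case True
    obtain l where l: "k = Suc l"
      using insert.prems(3) by (cases k) auto
    \<comment> \<open>At least \<open>k\<close> edges disappear, and k(k+1) - 2k = (k-1)k =
      l(l+1).\<close>
    have "2 * card ?E < l * (l + 1)"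
      using insert.prems(3) True cardE l by simp
    then obtain f where f: "proper_vertex_coloring V ?E l f"
      using insert.IH[of ?E l] insert.prems(1,2) by auto
    have "proper_vertex_coloring (insert v V) E k (f(v := l))"
      using f no_loop insert.hyps(2) unfolding proper_vertex_coloring_def l
      by (auto simp: less_Suc_eq)
    then show ?thesis
      by blast
  next
    case False
    have "2 * card ?E < k * (k + 1)"
      using insert.prems(3) cardE by simp
    then obtain f where f: "proper_vertex_coloring V ?E k f"
      using insert.IH[of ?E k] insert.prems(1,2) by auto
    let ?U = "{u. {u, v} \<in> E}"
    have inj: "inj_on (\<lambda>u. {u, v}) ?U"
      by (auto simp: inj_on_def doubleton_eq_iff)
    have sub: "(\<lambda>u. {u, v}) ` ?U \<subseteq> ?D"
      by auto
    have "finite ?D"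
      using insert.prems(1) by simp
    then have "finite ?U" "card ?U \<le> card ?D"
      using inj sub by (meson inj_on_finite, meson card_inj_on_le)
    then have "card (f ` ?U) < k" "finite (f ` ?U)"
      using card_image_le[of ?U f] False by auto
    then have "\<not> {..<k} \<subseteq> f ` ?U"
      using card_mono[of "f ` ?U" "{..<k}"] by auto
    then obtain a where a: "a < k" "a \<notin> f ` ?U"
      by blast
    have "proper_vertex_coloring (insert v V) E k (f(v := a))"
      using f a no_loop insert.hyps(2) unfolding proper_vertex_coloring_def
      by (auto simp: insert_commute)
    then show ?thesis
      by blast
  qed
qed

lemma coloring_add_vertices:
  assumes "finite S" "proper_vertex_coloring V {e \<in> E. e \<inter> S = {}} k f" "\<And>v. {v} \<notin> E"
  shows "\<exists>g. proper_vertex_coloring V E (k + card S) g"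
proof -
  obtain h where h: "bij_betw h S {0..<card S}"
    using ex_bij_betw_finite_nat[OF assms(1)] by blast
  have h_less: "h v < card S" if "v \<in> S" for v
    using bij_betwE[OF h] that by auto
  have h_inj: "u = v" if "u \<in> S" "v \<in> S" "h u = h v" for u v
    using h that by (auto simp: bij_betw_def inj_on_def)
  \<comment> \<open>The colors from \<open>k\<close> upwards are private to the vertices of
    \<open>S\<close>, so only edges avoiding \<open>S\<close> can cause conflicts.\<close>
  let ?g = "\<lambda>v. if v \<in> S then k + h v else f v"
  have f: "f v < k" if "v \<in> V" for v
    using assms(2) that unfolding proper_vertex_coloring_def by blast
  have "?g u \<noteq> ?g v" if uv: "u \<in> V" "v \<in> V" "{u, v} \<in> E" for u v
  proof -
    have "u \<noteq> v"
      using uv(3) assms(3) by auto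
    moreover have "f u \<noteq> f v" if "u \<notin> S" "v \<notin> S"
      using assms(2) uv that unfolding proper_vertex_coloring_def by auto
    ultimately show ?thesis
      using f[OF uv(1)] f[OF uv(2)] h_inj by auto
  qed
  moreover have "?g v < k + card S" if "v \<in> V" for v
    using f[OF that] h_less[of v] by auto
  ultimately have "proper_vertex_coloring V E (k + card S) ?g"
    unfolding proper_vertex_coloring_def by blast
  then show ?thesis
    by blast
qed

section \<open>Combination over all colors\<close>

lemma sum_clique_edges_less:
  fixes m :: "'i \<Rightarrow> nat"
  assumes "\<And>i. i \<in> I \<Longrightarrow> m i \<le> M"
  shows "2 * (\<Sum>i\<in>I. m i * (2 * m i + 1)) < (M + 1 + sum m I) * (M + 1 + sum m I + 1)"
proof -
  let ?s = "sum m I"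
  have "(\<Sum>i\<in>I. m i * (2 * m i + 1)) \<le> (\<Sum>i\<in>I. m i * (2 * M + 1))"
    using assms by (intro sum_mono mult_le_mono) auto
  then have "2 * (\<Sum>i\<in>I. m i * (2 * m i + 1)) \<le> 2 * (?s * (2 * M + 1))"
    by (simp only: sum_distrib_right)
  moreover have "2 * (?s * (2 * M + 1)) < (M + 1 + ?s) * (M + 1 + ?s + 1)"
  proof -
    \<comment> \<open>With s = \<open>sum m I\<close>, the right side exceeds the left by (M-s)^2 +
      3M + s + 2.\<close>
    have "0 \<le> (int M - int ?s)\<^sup>2"
      by simp
    then have "int (2 * (?s * (2 * M + 1))) < int ((M + 1 + ?s) * (M + 1 + ?s + 1))"
      by (simp add: power2_eq_square algebra_simps del: of_nat_sum)
    then show ?thesis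
      by (simp only: of_nat_less_iff)
  qed
  ultimately show ?thesis
    by linarith
qed

theorem theorem2:
  fixes t :: nat and n :: "nat \<Rightarrow> nat"
    and V :: "'a set" and E :: "'a set set" and c :: "'a set \<Rightarrow> nat"
  assumes "t \<ge> 1"
    and "\<And>i. i \<in> {1..t} \<Longrightarrow> n i > 0"
    and "n 1 = Max (n ` {1..t})"
    and "finite_simple_graph V E"
    and "chromatic_number V E \<ge> n 1 + 1 + (\<Sum>i\<in>{1..t}. (n i - 1))"
    and "\<And>e. e \<in> E \<Longrightarrow> c e \<in> {1..t}"
  shows "\<exists>i\<in>{1..t}. \<exists>M. M \<subseteq> E \<and> card M = n i \<and> pairwise disjnt M \<and> (\<forall>e\<in>M. c e = i)"
proof (rule ccontr)
  assume contra: "\<not> ?thesis"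
  interpret finite_simple_graph V E
    by fact
  let ?I = "{1..t}"
  have two: "card e = 2" if "e \<in> E" for e
    using edges[OF that] by blast
  have finE: "finite E"
    using edges finite_V by (intro finite_subset[of E "Pow V"]) auto
  define Q where "Q i S m \<longleftrightarrow> finite S \<and> card S + m \<le> n i - 1 \<and>
      card {e \<in> {e \<in> E. c e = i}. e \<inter> S = {}} \<le> m * (2 * m + 1)" for i S m
  have "\<exists>S m. Q i S m" if i: "i \<in> ?I" for i
    unfolding Q_def
  proof (rule bounded_matching_structure)
    fix M assume M: "matching_in {e \<in> E. c e = i} M"
    show "card M \<le> n i - 1"
    proof (rule ccontr)
      assume "\<not> card M \<le> n i - 1"
      then have "n i \<le> card M"
        by simp
      then obtain N where N: "N \<subseteq> M" "card N = n i"
        by (meson obtain_subset_with_card_n)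
      then have "N \<subseteq> E \<and> card N = n i \<and> pairwise disjnt N \<and> (\<forall>e\<in>N. c e = i)"
        using matching_in_subset[OF M N(1)] unfolding matching_in_def by blast
      with contra i show False
        by blast
    qed
  qed (use finE two in auto)
  then obtain S m where "\<And>i. i \<in> ?I \<Longrightarrow> Q i (S i) (m i)"
    by metis
  then have Sm: "finite (S i) \<and> card (S i) + m i \<le> n i - 1 \<and>
      card {e \<in> {e \<in> E. c e = i}. e \<inter> S i = {}} \<le> m i * (2 * m i + 1)"
    if "i \<in> ?I" for i
    using that unfolding Q_def by blast
  let ?S = "\<Union>i\<in>?I. S i"
  let ?E = "{e \<in> E. e \<inter> ?S = {}}"
  let ?k = "n 1 - 1 + 1 + sum m ?I"
  have finS: "finite ?S"
    using Sm by blast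
  \<comment> \<open>An edge avoiding every \<open>S i\<close> avoids in particular the set belonging
    to its own color, so it is counted there.\<close>
  have "?E \<subseteq> (\<Union>i\<in>?I. {e \<in> {e \<in> E. c e = i}. e \<inter> S i = {}})"
    using assms(6) by blast
  then have "card ?E \<le> card (\<Union>i\<in>?I. {e \<in> {e \<in> E. c e = i}. e \<inter> S i = {}})"
    using finE by (intro card_mono) auto
  also have "\<dots> \<le> (\<Sum>i\<in>?I. card {e \<in> {e \<in> E. c e = i}. e \<inter> S i = {}})"
    by (rule card_UN_le) simp
  also have "\<dots> \<le> (\<Sum>i\<in>?I. m i * (2 * m i + 1))"
    using Sm by (intro sum_mono) blast
  finally have cardE: "card ?E \<le> (\<Sum>i\<in>?I. m i * (2 * m i + 1))" .
  have "m i \<le> n 1 - 1" if "i \<in> ?I" for i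
  proof -
    have "n i \<le> n 1"
      using that assms(3) by simp
    then show ?thesis
      using Sm[OF that] by linarith
  qed
  from sum_clique_edges_less[of ?I m, OF this] have "2 * card ?E < ?k * (?k + 1)"
    using cardE by linarith
  then obtain f where f: "proper_vertex_coloring V ?E ?k f"
    using few_edges_colorable[of V ?E ?k] finite_V finE two by auto
  have "{v} \<notin> E" for v
    using two[of "{v}"] by auto
  then obtain g where "proper_vertex_coloring V E (?k + card ?S) g"
    using coloring_add_vertices[OF finS f] by blast
  then have "chromatic_number V E \<le> ?k + card ?S"
    unfolding chromatic_number_def by (intro Least_le) blast
  also have "card ?S \<le> (\<Sum>i\<in>?I. card (S i))"
    by (rule card_UN_le) simp
  \<comment> \<open>Positivity of \<open>n 1\<close> turns \<open>n 1 - 1 + 1\<close> back into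
    \<open>n 1\<close>. The resulting bound is one below the assumed chromatic number.\<close>
  also have "?k + (\<Sum>i\<in>?I. card (S i)) = n 1 + (\<Sum>i\<in>?I. card (S i) + m i)"
    using assms(1) assms(2)[of 1] by (simp add: sum.distrib)
  also have "(\<Sum>i\<in>?I. card (S i) + m i) \<le> (\<Sum>i\<in>?I. n i - 1)"
    using Sm by (intro sum_mono) blast
  finally show False
    using assms(5) by simp
qed

end
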